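(* Let $M\subset\mathbb{R}^n$ be a complete connected smooth Riemannian helix submanifold with respect to the unit direction $d\in\mathbb{R}^n$, with decomposition $d=\cos(\theta)T^*+\sin(\theta)\xi$ into tangent and normal components, and let $f:M\to\mathbb{R}$ be an affine function, where $T^*=\nabla f$ is the unit tangent component of the direction $d$. Let $\alpha=\alpha(s):I\subset\mathbb{R}\to M$ be an $f$-eikonal helix curve on $M$ with unit tangent $T$. If the normal component $\xi$ of $d$ is parallel normal in the direction $T$, then the $f$-eikonal helix curve $\alpha$ is a general helix.
   Context: $M$ carries the metric induced from $\mathbb{R}^n$. $M$ is a helix submanifold with respect to the unit vector $d$ if the angle between $d$ and $T_qM$ is the same for all $q\in M$; then $d=\cos(\theta)T^*+\sin(\theta)\xi$ along $M$, with $T^*$ a unit tangent field, $\xi$ a unit normal field, and $\theta$ constant, where it is assumed that $0<\theta<\frac{\pi}{2}$. $\nabla f$ is the gradient of $f$ on $M$. A function $f:M\to\mathbb{R}$ is affine if for each unit speed geodesic $\gamma:(-\infty,\infty)\to M$ there are constants $a,b\in\mathbb{R}$ with $f(\gamma(s))=as+b$ for all $s$. A curve $\alpha$ on $M$ with unit tangent $T$ is an $f$-eikonal helix curve if $\|\nabla f\|$ is constant along $\alpha$ and the angle between $\nabla f$ and $T$ is constant along $\alpha$. The field $\xi$ is parallel normal in the direction $X\in TM$ if $\nabla^{\perp}_X\xi=0$, where $\nabla^\perp$ is the normal connection of $M$ induced by the standard covariant derivative of $\mathbb{R}^n$. A curve in $\mathbb{R}^n$ with arc-length parameter and unit tangent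 $V_1$ is a general helix if there is a unit constant vector $X\in\mathbb{R}^n$ with $\langle V_1,X\rangle=\cos\varphi$ along the curve, where $\varphi$ is constant and $\varphi\neq\frac{\pi}{2}$.
   Formalization: The formal theorem additionally assumes that the constant angle between ∇f and T is not π/2; without this the claim fails, e.g. for a circle orthogonal to ∇f in a flat 3-space M in R^4, since a general helix requires φ ≠ π/2. *)

theory Defs
  imports "HOL-Analysis.Analysis"
begin

section \<open>Smooth maps, submanifolds of Euclidean space, tangent spaces\<close>

text \<open>Meant for open sets \<open>U\<close>: all iterated directional derivatives up to order \<open>k\<close> exist and
  are continuous, which on an open set is the usual notion of a \<open>C\<^sup>k\<close> map.\<close>

fun Ck_on :: "nat \<Rightarrow> 'a::euclidean_space set \<Rightarrow> ('a \<Rightarrow> 'b::euclidean_space) \<Rightarrow> bool" where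
  "Ck_on 0 U f \<longleftrightarrow> continuous_on U f"
| "Ck_on (Suc k) U f \<longleftrightarrow>
     (\<forall>x\<in>U. f differentiable (at x)) \<and> (\<forall>v. Ck_on k U (\<lambda>x. frechet_derivative f (at x) v))"

definition smooth_on :: "'a::euclidean_space set \<Rightarrow> ('a \<Rightarrow> 'b::euclidean_space) \<Rightarrow> bool" where
  "smooth_on U f \<longleftrightarrow> (\<forall>k. Ck_on k U f)"

text \<open>Embedded \<open>m\<close>-dimensional submanifold, by slice charts: near each point an ambient
  diffeomorphism \<open>\<Phi> : U \<rightarrow> V\<close> flattens \<open>M\<close> onto an \<open>m\<close>-dimensional linear subspace.\<close>

definition smooth_submanifold :: "nat \<Rightarrow> 'a::euclidean_space set \<Rightarrow> bool" where
  "smooth_submanifold m M \<longleftrightarrow>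
     (\<forall>p\<in>M. \<exists>U V (\<Phi> :: 'a \<Rightarrow> 'a) \<Psi> L.
        open U \<and> p \<in> U \<and> open V \<and> homeomorphism U V \<Phi> \<Psi> \<and> smooth_on U \<Phi> \<and> smooth_on V \<Psi> \<and>
        subspace L \<and> dim L = m \<and> \<Phi> ` (U \<inter> M) = V \<inter> L)"

definition smooth_map_on_submanifold ::
  "'a::euclidean_space set \<Rightarrow> ('a \<Rightarrow> 'b::euclidean_space) \<Rightarrow> bool" where
  "smooth_map_on_submanifold M g \<longleftrightarrow>
     (\<forall>p\<in>M. \<exists>U h. open U \<and> p \<in> U \<and> smooth_on U h \<and> (\<forall>x\<in>U \<inter> M. h x = g x))"

definition curve_through ::
  "'a::euclidean_space set \<Rightarrow> 'a \<Rightarrow> 'a \<Rightarrow> (real \<Rightarrow> 'a) \<Rightarrow> bool" where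
  "curve_through M p v \<gamma> \<longleftrightarrow>
     (\<exists>e>0. smooth_on {-e<..<e} \<gamma> \<and> \<gamma> ` {-e<..<e} \<subseteq> M) \<and>
     \<gamma> 0 = p \<and> (\<gamma> has_vector_derivative v) (at 0)"

definition tangent_space :: "'a::euclidean_space set \<Rightarrow> 'a \<Rightarrow> 'a set" where
  "tangent_space M p = {v. \<exists>\<gamma>. curve_through M p v \<gamma>}"

definition normal_space :: "'a::euclidean_space set \<Rightarrow> 'a \<Rightarrow> 'a set" where
  "normal_space M p = (tangent_space M p)\<^sup>\<bottom>"

text \<open>The closest point of a linear subspace is the orthogonal projection onto it.\<close>

definition tangential_part :: "'a::euclidean_space set \<Rightarrow> 'a \<Rightarrow> 'a \<Rightarrow> 'a" where
  "tangential_part M p v = closest_point (tangent_space M p) v"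

definition normal_part :: "'a::euclidean_space set \<Rightarrow> 'a \<Rightarrow> 'a \<Rightarrow> 'a" where
  "normal_part M p v = v - tangential_part M p v"

definition unit_tangent_field :: "'a::euclidean_space set \<Rightarrow> ('a \<Rightarrow> 'a) \<Rightarrow> bool" where
  "unit_tangent_field M X \<longleftrightarrow>
     smooth_map_on_submanifold M X \<and> (\<forall>p\<in>M. X p \<in> tangent_space M p \<and> norm (X p) = 1)"

definition unit_normal_field :: "'a::euclidean_space set \<Rightarrow> ('a \<Rightarrow> 'a) \<Rightarrow> bool" where
  "unit_normal_field M X \<longleftrightarrow>
     smooth_map_on_submanifold M X \<and> (\<forall>p\<in>M. X p \<in> normal_space M p \<and> norm (X p) = 1)"

section \<open>Induced geometry: gradient, connections, geodesics\<close>

text \<open>Riesz representative in \<open>T\<^sub>pM\<close> of the differential of \<open>f\<close>, for the induced metric.\<close>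

definition grad :: "'a::euclidean_space set \<Rightarrow> ('a \<Rightarrow> real) \<Rightarrow> 'a \<Rightarrow> 'a" where
  "grad M f p = (THE g. g \<in> tangent_space M p \<and>
     (\<forall>v \<gamma>. curve_through M p v \<gamma> \<longrightarrow> ((\<lambda>t. f (\<gamma> t)) has_real_derivative (g \<bullet> v)) (at 0)))"

text \<open>Standard covariant derivative of the ambient space: the derivative at \<open>p\<close>, in the tangent
  direction \<open>v\<close>, of a vector field \<open>Y\<close> that is only defined along \<open>M\<close>.\<close>

definition ambient_deriv ::
  "'a::euclidean_space set \<Rightarrow> ('a \<Rightarrow> 'a) \<Rightarrow> 'a \<Rightarrow> 'a \<Rightarrow> 'a" where
  "ambient_deriv M Y p v = (THE w.
     \<forall>\<gamma>. curve_through M p v \<gamma> \<longrightarrow> ((\<lambda>t. Y (\<gamma> t)) has_vector_derivative w) (at 0))"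

definition normal_connection ::
  "'a::euclidean_space set \<Rightarrow> ('a \<Rightarrow> 'a) \<Rightarrow> 'a \<Rightarrow> 'a \<Rightarrow> 'a" where
  "normal_connection M \<xi> p v = normal_part M p (ambient_deriv M \<xi> p v)"

definition parallel_normal ::
  "'a::euclidean_space set \<Rightarrow> ('a \<Rightarrow> 'a) \<Rightarrow> 'a \<Rightarrow> 'a \<Rightarrow> bool" where
  "parallel_normal M \<xi> p v \<longleftrightarrow> v \<in> tangent_space M p \<and> normal_connection M \<xi> p v = 0"

definition velocity :: "(real \<Rightarrow> 'a::euclidean_space) \<Rightarrow> real \<Rightarrow> 'a" where
  "velocity \<gamma> s = vector_derivative \<gamma> (at s)"

text \<open>Curves on open intervals; \<open>unit_speed_curve I M \<alpha>\<close> means that the parameter is arc length.\<close>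

definition smooth_curve :: "real set \<Rightarrow> 'a::euclidean_space set \<Rightarrow> (real \<Rightarrow> 'a) \<Rightarrow> bool" where
  "smooth_curve I M \<gamma> \<longleftrightarrow>
     open I \<and> is_interval I \<and> I \<noteq> {} \<and> smooth_on I \<gamma> \<and> \<gamma> ` I \<subseteq> M"

definition unit_speed_curve :: "real set \<Rightarrow> 'a::euclidean_space set \<Rightarrow> (real \<Rightarrow> 'a) \<Rightarrow> bool" where
  "unit_speed_curve I M \<gamma> \<longleftrightarrow> smooth_curve I M \<gamma> \<and> (\<forall>s\<in>I. norm (velocity \<gamma> s) = 1)"

text \<open>The Levi-Civita connection of the induced metric is the tangential part of the ambient one,
  so the covariant acceleration of \<open>\<gamma>\<close> in \<open>M\<close> is the tangential part of \<open>\<gamma>''\<close>.\<close>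

definition geodesic :: "real set \<Rightarrow> 'a::euclidean_space set \<Rightarrow> (real \<Rightarrow> 'a) \<Rightarrow> bool" where
  "geodesic I M \<gamma> \<longleftrightarrow>
     smooth_curve I M \<gamma> \<and> (\<forall>s\<in>I. tangential_part M (\<gamma> s) (velocity (velocity \<gamma>) s) = 0)"

text \<open>Geodesic completeness; for a connected manifold this is equivalent to metric completeness
  of the Riemannian distance (which may differ from the ambient distance).\<close>

definition complete_submanifold :: "'a::euclidean_space set \<Rightarrow> bool" where
  "complete_submanifold M \<longleftrightarrow>
     (\<forall>p\<in>M. \<forall>v\<in>tangent_space M p. \<exists>\<gamma>. geodesic UNIV M \<gamma> \<and> \<gamma> 0 = p \<and> velocity \<gamma> 0 = v)"

definition affine_function :: "'a::euclidean_space set \<Rightarrow> ('a \<Rightarrow> real) \<Rightarrow> bool" where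
  "affine_function M f \<longleftrightarrow>
     (\<forall>\<gamma>. geodesic UNIV M \<gamma> \<and> unit_speed_curve UNIV M \<gamma> \<longrightarrow>
        (\<exists>a b. \<forall>s. f (\<gamma> s) = a * s + b))"

section \<open>Helix submanifolds and helices\<close>

definition vec_angle :: "'a::euclidean_space \<Rightarrow> 'a \<Rightarrow> real" where
  "vec_angle u v = arccos (u \<bullet> v / (norm u * norm v))"

text \<open>The angle between a vector and a tangent space, through the length of the projection;
  it lies in \<open>[0, \<pi>/2]\<close>.\<close>

definition tangent_angle :: "'a::euclidean_space set \<Rightarrow> 'a \<Rightarrow> 'a \<Rightarrow> real" where
  "tangent_angle M q d = arccos (norm (tangential_part M q d) / norm d)"

definition helix_submanifold ::
  "nat \<Rightarrow> 'a::euclidean_space set \<Rightarrow> 'a \<Rightarrow> real \<Rightarrow> bool" where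
  "helix_submanifold m M d \<theta> \<longleftrightarrow>
     smooth_submanifold m M \<and> norm d = 1 \<and> (\<forall>q\<in>M. tangent_angle M q d = \<theta>)"

definition eikonal_helix_curve ::
  "real set \<Rightarrow> 'a::euclidean_space set \<Rightarrow> ('a \<Rightarrow> real) \<Rightarrow> (real \<Rightarrow> 'a) \<Rightarrow> bool" where
  "eikonal_helix_curve I M f \<alpha> \<longleftrightarrow>
     unit_speed_curve I M \<alpha> \<and>
     (\<exists>c. \<forall>s\<in>I. norm (grad M f (\<alpha> s)) = c) \<and>
     (\<exists>\<phi>. \<forall>s\<in>I. vec_angle (grad M f (\<alpha> s)) (velocity \<alpha> s) = \<phi>)"

text \<open>\<open>\<phi>\<close> is an angle between vectors, so it ranges over \<open>[0, \<pi>]\<close>. Without this restriction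
  \<open>\<phi> = 3\<pi>/2\<close> would defeat the condition \<open>\<phi> \<noteq> \<pi>/2\<close>.\<close>

definition general_helix :: "real set \<Rightarrow> (real \<Rightarrow> 'a::euclidean_space) \<Rightarrow> bool" where
  "general_helix I \<alpha> \<longleftrightarrow>
     unit_speed_curve I UNIV \<alpha> \<and>
     (\<exists>X \<phi>. norm X = 1 \<and> 0 \<le> \<phi> \<and> \<phi> \<le> pi \<and> \<phi> \<noteq> pi / 2 \<and>
        (\<forall>s\<in>I. velocity \<alpha> s \<bullet> X = cos \<phi>))"

end

theory Submission
  imports Defs
begin

text \<open>The axis of \<open>\<alpha>\<close> is \<open>d\<close> itself: the velocity is tangent to \<open>M\<close>, so its inner product with \<open>d\<close>
  only sees \<open>cos \<theta> *\<^sub>R Tstar\<close>, which is a constant multiple of the gradient of \<open>f\<close>.\<close>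

text \<open>Cauchy-Schwarz keeps the inner product in [-1, 1], the range on which \<open>cos\<close>
  undoes \<open>arccos\<close>.\<close>

lemma inner_eq_cos_vec_angle:
  assumes "norm u = 1" "norm v = 1"
  shows "u \<bullet> v = cos (vec_angle u v)"
proof -
  have "\<bar>u \<bullet> v\<bar> \<le> 1"
    using Cauchy_Schwarz_ineq2[of u v] assms by simp
  then show ?thesis
    using assms by (simp add: vec_angle_def cos_arccos_abs)
qed

lemma tangent_normal_inner_zero:
  assumes "v \<in> tangent_space M p" "w \<in> normal_space M p"
  shows "v \<bullet> w = 0"
  using assms by (auto simp: normal_space_def orthogonal_comp_def orthogonal_def)

theorem theorem5p1:
  fixes M :: "(real ^ 'n) set" and m :: nat and d :: "real ^ 'n" and \<theta> :: real
    and Tstar \<xi> :: "real ^ 'n \<Rightarrow> real ^ 'n"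
    and f :: "real ^ 'n \<Rightarrow> real"
    and I :: "real set" and \<alpha> :: "real \<Rightarrow> real ^ 'n"
  assumes helix: "helix_submanifold m M d \<theta>"
    and complete: "complete_submanifold M"
    and connected: "connected M"
    and theta: "0 < \<theta>" "\<theta> < pi / 2"
    and tangent: "unit_tangent_field M Tstar"
    and normal: "unit_normal_field M \<xi>"
    and decomposition: "\<And>q. q \<in> M \<Longrightarrow> d = cos \<theta> *\<^sub>R Tstar q + sin \<theta> *\<^sub>R \<xi> q"
    and smooth: "smooth_map_on_submanifold M f"
    and affine: "affine_function M f"
    and gradient: "\<And>q. q \<in> M \<Longrightarrow> Tstar q = grad M f q"
    and eikonal: "eikonal_helix_curve I M f \<alpha>"
    and not_right_angle: "\<And>s. s \<in> I \<Longrightarrow> vec_angle (grad M f (\<alpha> s)) (velocity \<alpha> s) \<noteq> pi / 2"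
    and parallel: "\<And>s. s \<in> I \<Longrightarrow> parallel_normal M \<xi> (\<alpha> s) (velocity \<alpha> s)"
  shows "general_helix I \<alpha>"
proof -
  from eikonal obtain \<phi> where curve: "unit_speed_curve I M \<alpha>"
    and angle: "\<And>s. s \<in> I \<Longrightarrow> vec_angle (grad M f (\<alpha> s)) (velocity \<alpha> s) = \<phi>"
    unfolding eikonal_helix_curve_def by blast
  have curve_M: "\<alpha> s \<in> M" "norm (velocity \<alpha> s) = 1" if "s \<in> I" for s
    using curve that by (auto simp: unit_speed_curve_def smooth_curve_def)
  have curve_UNIV: "unit_speed_curve I UNIV \<alpha>"
    using curve by (auto simp: unit_speed_curve_def smooth_curve_def)
  have grad_velocity: "grad M f (\<alpha> s) \<bullet> velocity \<alpha> s = cos \<phi>" if s: "s \<in> I" for s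
  proof -
    \<comment> \<open>The gradient coincides with the unit field \<open>Tstar\<close>, so the
      constant angle \<phi> turns into a constant inner product with no length factor.\<close>
    have "norm (grad M f (\<alpha> s)) = 1"
      using tangent gradient[OF curve_M(1)[OF s]] curve_M(1)[OF s]
      by (metis unit_tangent_field_def)
    then show ?thesis
      using inner_eq_cos_vec_angle curve_M(2)[OF s] angle[OF s] by metis
  qed
  have d_velocity: "velocity \<alpha> s \<bullet> d = cos \<theta> * cos \<phi>" if s: "s \<in> I" for s
  proof -
    \<comment> \<open>Tangency of the velocity is read off from the first conjunct of
      \<open>parallel_normal\<close>.\<close>
    have "velocity \<alpha> s \<bullet> \<xi> (\<alpha> s) = 0"
      using parallel[OF s] normal curve_M(1)[OF s]
      by (auto simp: parallel_normal_def unit_normal_field_def intro: tangent_normal_inner_zero)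
    then show ?thesis
      using decomposition[OF curve_M(1)[OF s]] gradient[OF curve_M(1)[OF s]] grad_velocity[OF s]
      by (simp add: inner_add_right inner_commute)
  qed
  obtain s0 where s0: "s0 \<in> I"
    using curve by (auto simp: unit_speed_curve_def smooth_curve_def)
  have d_norm: "norm d = 1"
    using helix by (simp add: helix_submanifold_def)
  \<comment> \<open>The helix angle may be measured at the single parameter \<open>s0\<close>,
    because \<open>d_velocity\<close> does not depend on the parameter. Taking it as an
    \<open>arccos\<close> places it in the interval from 0 to \<open>pi\<close> that
    \<open>general_helix\<close> requires.\<close>
  let ?\<psi> = "vec_angle (velocity \<alpha> s0) d"
  have \<psi>: "cos ?\<psi> = cos \<theta> * cos \<phi>"
    using inner_eq_cos_vec_angle[OF curve_M(2)[OF s0] d_norm] d_velocity[OF s0] by simp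
  have "\<bar>velocity \<alpha> s0 \<bullet> d\<bar> \<le> 1"
    using Cauchy_Schwarz_ineq2[of "velocity \<alpha> s0" d] curve_M(2)[OF s0] d_norm by simp
  then have range: "0 \<le> ?\<psi>" "?\<psi> \<le> pi"
    using curve_M(2)[OF s0] d_norm by (auto simp: vec_angle_def abs_le_iff arccos_lbound arccos_ubound)
  \<comment> \<open>A right angle here would make the curve orthogonal to \<open>d\<close>, the case
    that \<open>general_helix\<close> rules out for its axis.\<close>
  have "\<phi> \<noteq> pi / 2"
    using not_right_angle[OF s0] angle[OF s0] by simp
  \<comment> \<open>As a value of \<open>arccos\<close>, \<phi> is determined by its cosine:
    \<open>cos \<phi> = 0\<close> would force \<phi> to be \<open>arccos 0\<close>, that is
    \<open>pi / 2\<close>.\<close>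
  moreover have "\<phi> = arccos (cos \<phi>)"
    using angle[OF s0] grad_velocity[OF s0] curve_M[OF s0] tangent gradient[OF curve_M(1)[OF s0]]
    unfolding vec_angle_def unit_tangent_field_def by (metis div_by_1 mult_1)
  ultimately have "cos \<phi> \<noteq> 0"
    by auto
  moreover have "cos \<theta> > 0"
    using theta by (simp add: cos_gt_zero)
  ultimately have "?\<psi> \<noteq> pi / 2"
    using \<psi> by (metis cos_pi_half less_irrefl mult_eq_0_iff)
  then show ?thesis
    unfolding general_helix_def using curve_UNIV d_norm range d_velocity \<psi> by metis
qed

end
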